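(* Let $G=A_5\times\mathbb Z_2=A_5\times\langle a\rangle$ with $|a|=2$, and let $r_0,r_1,r_2\in G$ be involutions with $G=\langle r_0,r_1,r_2\rangle$ such that $\mathcal M(G;r_0,r_1,r_2)$ is a regular linear hypermap; put $H=\langle r_1,r_2\rangle$, $K=\langle r_0,r_2\rangle$. Then $\mathcal M(G;r_0,r_1,r_2)$ is isomorphic to one of the following: $\mathcal M_1=\mathcal M(G;(12)(35),(12)(34)a,(14)(23))$; $\mathcal M_2=\mathcal M(G;(12)(35),(13)(24)a,(14)(23))$; $\mathcal M_3=\mathcal M(G;(12)(35)a,(12)(34)a,(13)(24)a)$; $\mathcal M_4=\mathcal M(G;(12)(35)a,(13)(24)a,(12)(34)a)$; $\mathcal M_5=\mathcal M(G;(12)(35)a,(14)(23),(12)(34)a)$; $\mathcal M_6=\mathcal M(G;(14)(25)a,(12)(34)a,(13)(24)a)$; $\mathcal M_7=\mathcal M(G;(12)(35)a,(14)(23),(13)(24)a)$; $\mathcal M_8=\mathcal M(G;(14)(25),(12)(34)a,(14)(23))$; $\mathcal M_9=\mathcal M(G;(14)(25)a,(14)(23),(12)(34)a)$; $\mathcal M_{10}=\mathcal M(G;(14)(35)a,(12)(45),(13)(45))$; $\mathcal M_{11}=\mathcal M(G;(14)(35)a,(12)(45)a,(13)(45)a)$; $\mathcal M_{12}=\mathcal M(G;(13)(24)a,(12)(45)a,(13)(45)a)$; $\mathcal M_{13}=\mathcal M(G;(14)(35),(12)(45)a,(13)(45)a)$; $\mathcal M_{14}=\mathcal M(G;(14)(35)a,(14)(23),(13)(45))$;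 $\mathcal M_{15}=\mathcal M(G;(15)(34)a,(14)(23),(13)(45))$; $\mathcal M_{16}=\mathcal M(G;(14)(35)a,(14)(23)a,(13)(45)a)$; $\mathcal M_{17}=\mathcal M(G;(15)(34)a,(14)(23)a,(13)(45)a)$; $\mathcal M_{18}=\mathcal M(G;(14)(35),(14)(23)a,(13)(45)a)$; $\mathcal M_{19}=\mathcal M(G;(15)(34),(14)(23)a,(13)(45)a)$. Moreover, the linear hypermaps $\mathcal M_1,\dots,\mathcal M_{19}$ are pairwise non-isomorphic.
   Context: $A_5$ acts on $\{1,2,3,4,5\}$ and its elements are written as products of disjoint cycles; $a$ is the generator of the direct factor $\mathbb Z_2$. Let $G$ be a finite group and $r_0,r_1,r_2\in G$ pairwise distinct involutions with $G=\langle r_0,r_1,r_2\rangle$. $\mathcal M(G;r_0,r_1,r_2)$ is a regular linear hypermap if (1) $\langle r_1,r_2\rangle\cap\langle r_0,r_2\rangle=\langle r_2\rangle$ and (2) $\langle r_1,r_2\rangle\langle r_0,r_2\rangle\cap\langle r_0,r_2\rangle\langle r_1,r_2\rangle=\langle r_1,r_2\rangle\cup\langle r_0,r_2\rangle$ (products of subsets). Its flags are the elements of $G$ with $r_i$ acting by right multiplication. Two such hypermaps $\mathcal M(G;r_i)$ and $\mathcal M(G';s_i)$ are isomorphic if there is a bijection $\sigma:G\to G'$ with $(xr_i)^\sigma=x^\sigma s_i$ for all $x\in G$, $i=0,1,2$. *)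

theory Defs
  imports "HOL-Algebra.Sym_Groups" "HOL-Algebra.Elementary_Groups"
begin

text \<open>\<open>Hypermap G r0 r1 r2\<close> is $\mathcal M(G; r_0, r_1, r_2)$: its flags are the elements of
  \<open>carrier G\<close>, on which the three generators act by right multiplication.\<close>

datatype 'g hypermap = Hypermap (hgroup: "'g monoid") (gen0: 'g) (gen1: 'g) (gen2: 'g)

definition involution :: "('g, 'm) monoid_scheme \<Rightarrow> 'g \<Rightarrow> bool" where
  "involution G x \<longleftrightarrow> x \<in> carrier G \<and> x \<noteq> \<one>\<^bsub>G\<^esub> \<and> x \<otimes>\<^bsub>G\<^esub> x = \<one>\<^bsub>G\<^esub>"

definition regular_linear_hypermap :: "'g hypermap \<Rightarrow> bool" where
  "regular_linear_hypermap M \<longleftrightarrow>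
    (let G = hgroup M; r0 = gen0 M; r1 = gen1 M; r2 = gen2 M;
         H = generate G {r1, r2}; K = generate G {r0, r2}
     in group G \<and> finite (carrier G) \<and>
        involution G r0 \<and> involution G r1 \<and> involution G r2 \<and>
        r0 \<noteq> r1 \<and> r0 \<noteq> r2 \<and> r1 \<noteq> r2 \<and>
        generate G {r0, r1, r2} = carrier G \<and>
        H \<inter> K = generate G {r2} \<and>
        (H <#>\<^bsub>G\<^esub> K) \<inter> (K <#>\<^bsub>G\<^esub> H) = H \<union> K)"

definition hypermap_iso :: "'g hypermap \<Rightarrow> 'h hypermap \<Rightarrow> bool" where
  "hypermap_iso M N \<longleftrightarrow>
    (\<exists>\<sigma>. bij_betw \<sigma> (carrier (hgroup M)) (carrier (hgroup N)) \<and>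
      (\<forall>x \<in> carrier (hgroup M).
        \<sigma> (x \<otimes>\<^bsub>hgroup M\<^esub> gen0 M) = \<sigma> x \<otimes>\<^bsub>hgroup N\<^esub> gen0 N \<and>
        \<sigma> (x \<otimes>\<^bsub>hgroup M\<^esub> gen1 M) = \<sigma> x \<otimes>\<^bsub>hgroup N\<^esub> gen1 N \<and>
        \<sigma> (x \<otimes>\<^bsub>hgroup M\<^esub> gen2 M) = \<sigma> x \<otimes>\<^bsub>hgroup N\<^esub> gen2 N))"

text \<open>The library's \<open>alt_group 5\<close> consists of the even permutations of \<open>{1..5}\<close>, multiplied by
  \<open>\<circ>\<close>, i.e. from right to left. Multiplying from left to right instead gives the opposite group;
  inversion identifies the two and fixes involutions, so neither linearity nor isomorphism of
  hypermaps depends on this choice.\<close>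

definition A5Z2 :: "((nat \<Rightarrow> nat) \<times> int) monoid" where
  "A5Z2 = alt_group 5 \<times>\<times> integer_mod_group 2"

text \<open>\<open>dt i j k l\<close> is $(i\,j)(k\,l)$ and \<open>dta i j k l\<close> is $(i\,j)(k\,l)a$, where $a$ is the
  element \<open>(id, 1)\<close>.\<close>

definition dt :: "nat \<Rightarrow> nat \<Rightarrow> nat \<Rightarrow> nat \<Rightarrow> (nat \<Rightarrow> nat) \<times> int" where
  "dt i j k l = (transpose i j \<circ> transpose k l, 0)"

definition dta :: "nat \<Rightarrow> nat \<Rightarrow> nat \<Rightarrow> nat \<Rightarrow> (nat \<Rightarrow> nat) \<times> int" where
  "dta i j k l = (transpose i j \<circ> transpose k l, 1)"

text \<open>\<open>MM i\<close> is $\mathcal M_i$, for \<open>i\<close> from 1 to 19 (list positions start at 0).\<close>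

definition MM :: "nat \<Rightarrow> ((nat \<Rightarrow> nat) \<times> int) hypermap" where
  "MM i =
   [Hypermap A5Z2 (dt  1 2 3 5) (dta 1 2 3 4) (dt  1 4 2 3),
    Hypermap A5Z2 (dt  1 2 3 5) (dta 1 3 2 4) (dt  1 4 2 3),
    Hypermap A5Z2 (dta 1 2 3 5) (dta 1 2 3 4) (dta 1 3 2 4),
    Hypermap A5Z2 (dta 1 2 3 5) (dta 1 3 2 4) (dta 1 2 3 4),
    Hypermap A5Z2 (dta 1 2 3 5) (dt  1 4 2 3) (dta 1 2 3 4),
    Hypermap A5Z2 (dta 1 4 2 5) (dta 1 2 3 4) (dta 1 3 2 4),
    Hypermap A5Z2 (dta 1 2 3 5) (dt  1 4 2 3) (dta 1 3 2 4),
    Hypermap A5Z2 (dt  1 4 2 5) (dta 1 2 3 4) (dt  1 4 2 3),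
    Hypermap A5Z2 (dta 1 4 2 5) (dt  1 4 2 3) (dta 1 2 3 4),
    Hypermap A5Z2 (dta 1 4 3 5) (dt  1 2 4 5) (dt  1 3 4 5),
    Hypermap A5Z2 (dta 1 4 3 5) (dta 1 2 4 5) (dta 1 3 4 5),
    Hypermap A5Z2 (dta 1 3 2 4) (dta 1 2 4 5) (dta 1 3 4 5),
    Hypermap A5Z2 (dt  1 4 3 5) (dta 1 2 4 5) (dta 1 3 4 5),
    Hypermap A5Z2 (dta 1 4 3 5) (dt  1 4 2 3) (dt  1 3 4 5),
    Hypermap A5Z2 (dta 1 5 3 4) (dt  1 4 2 3) (dt  1 3 4 5),
    Hypermap A5Z2 (dta 1 4 3 5) (dta 1 4 2 3) (dta 1 3 4 5),
    Hypermap A5Z2 (dta 1 5 3 4) (dta 1 4 2 3) (dta 1 3 4 5),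
    Hypermap A5Z2 (dt  1 4 3 5) (dta 1 4 2 3) (dta 1 3 4 5),
    Hypermap A5Z2 (dt  1 5 3 4) (dta 1 4 2 3) (dta 1 3 4 5)] ! (i - 1)"

end

theory Submission
  imports Defs
begin

text \<open>An involution of $A_5 \times \langle a\rangle$ is $pa^e$ with $p^2 = 1$ in $A_5$. If $r_i = p_ia^{e_i}$
  generate, then $p_0, p_1, p_2$ generate $A_5$, so $p_1 \neq p_2$ are involutions, and $S_5$ has only
  three orbits on such pairs. With $(p_1, p_2)$ fixed in each orbit, a finite search over $p_0$ and
  the $e_i$ leaves only conjugates of the 19 listed triples under $S_5$, which acts by automorphisms.
  Linearity is decided by the criterion that $hk \in KH$ for $h \in H \setminus K$ and
  $k \in K \setminus H$ iff some $k'hk$ with $k' \in K$ lies in $H$. The 19 triples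
  are told apart by the orders of $r_0r_1$, $r_0r_2$, $r_1r_2$ and $r_0r_1r_2$, invariants of the action
  on flags.\<close>

section \<open>Regular linear hypermaps and group isomorphisms\<close>

lemma hypermap_iso_of_iso:
  assumes \<phi>: "\<phi> \<in> iso G G'" and r: "r0 \<in> carrier G" "r1 \<in> carrier G" "r2 \<in> carrier G"
  shows "hypermap_iso (Hypermap G r0 r1 r2) (Hypermap G' (\<phi> r0) (\<phi> r1) (\<phi> r2))"
  unfolding hypermap_iso_def using assms
  by (intro exI[of _ \<phi>]) (auto simp: iso_def hom_mult)

lemma image_set_mult:
  assumes "\<phi> \<in> hom G G'" "H \<subseteq> carrier G" "K \<subseteq> carrier G"
  shows "\<phi> ` (H <#>\<^bsub>G\<^esub> K) = \<phi> ` H <#>\<^bsub>G'\<^esub> \<phi> ` K"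
proof -
  have "\<phi> (h \<otimes>\<^bsub>G\<^esub> k) = \<phi> h \<otimes>\<^bsub>G'\<^esub> \<phi> k" if "h \<in> H" "k \<in> K" for h k
    using that assms(2,3) by (intro hom_mult[OF assms(1)]) auto
  thus ?thesis
    unfolding set_mult_def by (simp add: image_UN cong: SUP_cong_simp)
qed

text \<open>Carries linearity from \<open>A5Z2\<close> to its computable copy, along conjugations
  inside the copy, and back for the listed triples.\<close>

lemma regular_linear_hypermap_iso:
  assumes "group G" "group G'" and \<phi>: "\<phi> \<in> iso G G'"
    and M: "regular_linear_hypermap (Hypermap G r0 r1 r2)"
  shows "regular_linear_hypermap (Hypermap G' (\<phi> r0) (\<phi> r1) (\<phi> r2))"
proof -
  interpret G: group G by fact
  interpret G': group G' by fact
  have hom: "\<phi> \<in> hom G G'" and bij: "bij_betw \<phi> (carrier G) (carrier G')"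
    using \<phi> by (auto simp: iso_def)
  interpret group_hom G G' \<phi> by unfold_locales (fact hom)
  have inj: "inj_on \<phi> (carrier G)" and im: "\<phi> ` carrier G = carrier G'"
    using bij by (auto simp: bij_betw_def)
  define H where "H = generate G {r1, r2}"
  define K where "K = generate G {r0, r2}"
  have fin: "finite (carrier G)" and inv: "involution G r0" "involution G r1" "involution G r2"
    and ne: "r0 \<noteq> r1" "r0 \<noteq> r2" "r1 \<noteq> r2" and gen: "generate G {r0, r1, r2} = carrier G"
    and cap: "H \<inter> K = generate G {r2}" and lin: "(H <#>\<^bsub>G\<^esub> K) \<inter> (K <#>\<^bsub>G\<^esub> H) = H \<union> K"
    using M by (auto simp: regular_linear_hypermap_def Let_def H_def K_def)
  have r: "r0 \<in> carrier G" "r1 \<in> carrier G" "r2 \<in> carrier G"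
    using inv by (auto simp: involution_def)
  have sub: "H \<subseteq> carrier G" "K \<subseteq> carrier G"
    using r G.generate_incl unfolding H_def K_def by auto
  have prod: "H <#>\<^bsub>G\<^esub> K \<subseteq> carrier G" "K <#>\<^bsub>G\<^esub> H \<subseteq> carrier G"
    using sub by (auto simp: G.set_mult_closed)
  have inv': "involution G' (\<phi> r)" if "involution G r" for r
  proof -
    have "r \<in> carrier G" "r \<noteq> \<one>\<^bsub>G\<^esub>" "r \<otimes>\<^bsub>G\<^esub> r = \<one>\<^bsub>G\<^esub>"
      using that by (auto simp: involution_def)
    moreover have "\<phi> r \<noteq> \<phi> \<one>\<^bsub>G\<^esub>"
      using calculation inj by (metis G.one_closed inj_onD)
    ultimately show ?thesis
      unfolding involution_def by (metis hom_closed hom_mult hom_one)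
  qed
  have ne': "\<phi> r0 \<noteq> \<phi> r1" "\<phi> r0 \<noteq> \<phi> r2" "\<phi> r1 \<noteq> \<phi> r2"
    using ne r inj by (auto dest: inj_onD)
  have H': "generate G' {\<phi> r1, \<phi> r2} = \<phi> ` H" and K': "generate G' {\<phi> r0, \<phi> r2} = \<phi> ` K"
    and C': "generate G' {\<phi> r2} = \<phi> ` generate G {r2}"
    and g': "generate G' {\<phi> r0, \<phi> r1, \<phi> r2} = \<phi> ` generate G {r0, r1, r2}"
    using r by (simp_all add: H_def K_def flip: generate_img)
  \<comment> \<open>Any homomorphism respects products of subsets; for intersections injectivity is
    used.\<close>
  have cap': "\<phi> ` H \<inter> \<phi> ` K = \<phi> ` generate G {r2}"
    using inj_on_image_Int[OF inj sub] cap by simp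
  have "(\<phi> ` H <#>\<^bsub>G'\<^esub> \<phi> ` K) \<inter> (\<phi> ` K <#>\<^bsub>G'\<^esub> \<phi> ` H)
      = \<phi> ` ((H <#>\<^bsub>G\<^esub> K) \<inter> (K <#>\<^bsub>G\<^esub> H))"
    using sub prod by (simp add: inj_on_image_Int[OF inj] flip: image_set_mult[OF hom])
  also have "\<dots> = \<phi> ` H \<union> \<phi> ` K"
    by (simp add: lin image_Un)
  finally have lin': "(\<phi> ` H <#>\<^bsub>G'\<^esub> \<phi> ` K) \<inter> (\<phi> ` K <#>\<^bsub>G'\<^esub> \<phi> ` H) = \<phi> ` H \<union> \<phi> ` K" .
  have fin': "finite (carrier G')"
    using fin im by (metis finite_imageI)
  show ?thesis
    unfolding regular_linear_hypermap_def Let_def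
    using inv' inv ne' H' K' C' g' gen im cap' lin' fin' \<open>group G'\<close> by simp
qed

text \<open>The union of \<open>H\<close> and \<open>K\<close> always lies in both products. If
  \<open>h k = k1 h1\<close>, then \<open>inv k1 h k\<close> lies in \<open>H\<close>, and
  \<open>h \<in> K\<close> or \<open>k \<in> H\<close> puts \<open>h k\<close> into the union.
  Conversely, \<open>h k\<close> in the union forces one of these, because \<open>H\<close> and
  \<open>K\<close> are subgroups.\<close>

lemma (in group) set_mult_Int_set_mult_eq_Un_iff:
  assumes H: "subgroup H G" and K: "subgroup K G"
  shows "(H <#> K) \<inter> (K <#> H) = H \<union> K \<longleftrightarrow>
    (\<forall>h\<in>H - K. \<forall>k\<in>K - H. \<forall>k'\<in>K. k' \<otimes> (h \<otimes> k) \<notin> H)"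
proof -
  interpret H: subgroup H G by fact
  interpret K: subgroup K G by fact
  show ?thesis
  proof (intro iffI ballI notI)
    fix h k k'
    assume eq: "(H <#> K) \<inter> (K <#> H) = H \<union> K" and h: "h \<in> H - K" and k: "k \<in> K - H"
      and k': "k' \<in> K" and mem: "k' \<otimes> (h \<otimes> k) \<in> H"
    have car: "h \<in> carrier G" "k \<in> carrier G" "k' \<in> carrier G"
      using h k k' by auto
    have "h \<otimes> k = inv k' \<otimes> (k' \<otimes> (h \<otimes> k))"
      using car by (simp add: m_assoc[symmetric])
    hence "h \<otimes> k \<in> K <#> H"
      using k' mem by (auto simp: set_mult_def)
    moreover have "h \<otimes> k \<in> H <#> K"
      using h k by (auto simp: set_mult_def)
    ultimately have "h \<otimes> k \<in> H \<union> K" using eq by blast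
    moreover have "k \<in> H" if "h \<otimes> k \<in> H"
    proof -
      have "inv h \<otimes> (h \<otimes> k) \<in> H" using h that by blast
      thus ?thesis using car by (simp add: m_assoc[symmetric])
    qed
    moreover have "h \<in> K" if "h \<otimes> k \<in> K"
    proof -
      have "(h \<otimes> k) \<otimes> inv k \<in> K" using k that by blast
      thus ?thesis using car by (simp add: m_assoc)
    qed
    ultimately show False using h k by blast
  next
    assume *: "\<forall>h\<in>H - K. \<forall>k\<in>K - H. \<forall>k'\<in>K. k' \<otimes> (h \<otimes> k) \<notin> H"
    show "(H <#> K) \<inter> (K <#> H) = H \<union> K"
    proof (intro equalityI subsetI)
      fix x assume x: "x \<in> (H <#> K) \<inter> (K <#> H)"
      then obtain h k k1 h1 where e: "h \<in> H" "k \<in> K" "x = h \<otimes> k" "k1 \<in> K" "h1 \<in> H" "x = k1 \<otimes> h1"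
        by (auto simp: set_mult_def)
      have "inv k1 \<otimes> (h \<otimes> k) = h1"
        using e by (metis H.mem_carrier K.mem_carrier inv_solve_left' m_closed)
      hence "h \<in> K \<or> k \<in> H"
        using * e by (metis DiffI K.m_inv_closed)
      thus "x \<in> H \<union> K" using e by auto
    next
      fix x assume x: "x \<in> H \<union> K"
      hence car: "x \<in> carrier G" by auto
      have "x \<otimes> \<one> \<in> (H <#> K) \<and> \<one> \<otimes> x \<in> (K <#> H) \<or> \<one> \<otimes> x \<in> (H <#> K) \<and> x \<otimes> \<one> \<in> (K <#> H)"
        using x H.one_closed K.one_closed unfolding set_mult_def by blast
      thus "x \<in> (H <#> K) \<inter> (K <#> H)" using car by simp
    qed
  qed
qed

section \<open>Words in the generators acting on flags\<close>

definition gens :: "'g hypermap \<Rightarrow> 'g list" where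
  "gens M = [gen0 M, gen1 M, gen2 M]"

text \<open>Words are lists of generator indices, so that one word can be read in two
  hypermaps.\<close>

definition walk :: "'g hypermap \<Rightarrow> 'g \<Rightarrow> nat list \<Rightarrow> 'g" where
  "walk M = foldl (\<lambda>x i. x \<otimes>\<^bsub>hgroup M\<^esub> gens M ! i)"

lemma walk_in_carrier:
  assumes "group (hgroup M)" "set (gens M) \<subseteq> carrier (hgroup M)" "set ws \<subseteq> {..<3}"
    "x \<in> carrier (hgroup M)"
  shows "walk M x ws \<in> carrier (hgroup M)"
proof -
  interpret group "hgroup M" by fact
  have "gens M ! i \<in> carrier (hgroup M)" if "i < 3" for i
    using assms(2) that by (metis gens_def length_Cons list.size(3) nth_mem numeral_3_eq_3 subsetD)
  thus ?thesis
    using assms(3,4) by (induction ws arbitrary: x) (auto simp: walk_def)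
qed

text \<open>Right multiplication by generators commutes with left multiplication by group elements,
  so all flags behave alike under a word.\<close>

lemma walk_mult:
  assumes "group (hgroup M)" "set (gens M) \<subseteq> carrier (hgroup M)" "set ws \<subseteq> {..<3}"
    "x \<in> carrier (hgroup M)" "y \<in> carrier (hgroup M)"
  shows "walk M (x \<otimes>\<^bsub>hgroup M\<^esub> y) ws = x \<otimes>\<^bsub>hgroup M\<^esub> walk M y ws"
proof -
  interpret group "hgroup M" by fact
  have "gens M ! i \<in> carrier (hgroup M)" if "i < 3" for i
    using assms(2) that by (metis gens_def length_Cons list.size(3) nth_mem numeral_3_eq_3 subsetD)
  thus ?thesis
    using assms(3-) by (induction ws arbitrary: y) (auto simp: walk_def m_assoc)
qed

text \<open>A word in the generators fixes one flag if and only if it fixes every flag.\<close>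

lemma hypermap_iso_relator:
  assumes "hypermap_iso M N"
    and M: "group (hgroup M)" "set (gens M) \<subseteq> carrier (hgroup M)"
    and N: "group (hgroup N)" "set (gens N) \<subseteq> carrier (hgroup N)"
    and ws: "set ws \<subseteq> {..<3}"
  shows "walk M \<one>\<^bsub>hgroup M\<^esub> ws = \<one>\<^bsub>hgroup M\<^esub> \<longleftrightarrow> walk N \<one>\<^bsub>hgroup N\<^esub> ws = \<one>\<^bsub>hgroup N\<^esub>"
proof -
  interpret M: group "hgroup M" by fact
  interpret N: group "hgroup N" by fact
  obtain \<sigma> where bij: "bij_betw \<sigma> (carrier (hgroup M)) (carrier (hgroup N))"
    and hom: "\<And>x. x \<in> carrier (hgroup M) \<Longrightarrow>
      \<sigma> (x \<otimes>\<^bsub>hgroup M\<^esub> gen0 M) = \<sigma> x \<otimes>\<^bsub>hgroup N\<^esub> gen0 N \<and>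
      \<sigma> (x \<otimes>\<^bsub>hgroup M\<^esub> gen1 M) = \<sigma> x \<otimes>\<^bsub>hgroup N\<^esub> gen1 N \<and>
      \<sigma> (x \<otimes>\<^bsub>hgroup M\<^esub> gen2 M) = \<sigma> x \<otimes>\<^bsub>hgroup N\<^esub> gen2 N"
    using assms(1) unfolding hypermap_iso_def by blast
  have step: "\<sigma> (x \<otimes>\<^bsub>hgroup M\<^esub> gens M ! i) = \<sigma> x \<otimes>\<^bsub>hgroup N\<^esub> gens N ! i"
    if "x \<in> carrier (hgroup M)" "i < 3" for x i
    using hom[OF that(1)] that(2) by (auto simp: gens_def less_Suc_eq numeral_3_eq_3)
  have walk: "\<sigma> (walk M x ws) = walk N (\<sigma> x) ws" if "x \<in> carrier (hgroup M)" for x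
    using ws that
  proof (induction ws arbitrary: x)
    case (Cons i ws)
    have "x \<otimes>\<^bsub>hgroup M\<^esub> gens M ! i \<in> carrier (hgroup M)"
      using walk_in_carrier[OF M, of "[i]" x] Cons.prems by (simp add: walk_def)
    thus ?case
      using Cons step by (simp add: walk_def)
  qed (simp add: walk_def)
  \<comment> \<open>\<open>\<sigma>\<close> need not send the identity to the identity, so its image
    \<open>y\<close> serves as base point and is cancelled at the end.\<close>
  define y where "y = \<sigma> \<one>\<^bsub>hgroup M\<^esub>"
  have y: "y \<in> carrier (hgroup N)"
    using bij by (auto simp: y_def bij_betw_def)
  have "walk M \<one>\<^bsub>hgroup M\<^esub> ws = \<one>\<^bsub>hgroup M\<^esub> \<longleftrightarrow> walk N y ws = y"
    using bij walk[of "\<one>\<^bsub>hgroup M\<^esub>"] walk_in_carrier[OF M ws]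
    by (metis M.one_closed bij_betw_def inj_onD y_def)
  also have "walk N y ws = y \<otimes>\<^bsub>hgroup N\<^esub> walk N \<one>\<^bsub>hgroup N\<^esub> ws"
    using walk_mult[OF N ws y N.one_closed] y by simp
  also have "\<dots> = y \<longleftrightarrow> walk N \<one>\<^bsub>hgroup N\<^esub> ws = \<one>\<^bsub>hgroup N\<^esub>"
    using y walk_in_carrier[OF N ws] by simp
  finally show ?thesis .
qed

section \<open>An executable copy of the group\<close>

datatype point = P1 | P2 | P3 | P4 | P5

text \<open>\<open>EPerm a b c d e z\<close> stands for the permutation $1 \mapsto a, \dots, 5 \mapsto e$ times $a^z$.\<close>

datatype eperm = EPerm point point point point point bool

fun ap :: "eperm \<Rightarrow> point \<Rightarrow> point" where
  "ap (EPerm a b c d e z) P1 = a"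
| "ap (EPerm a b c d e z) P2 = b"
| "ap (EPerm a b c d e z) P3 = c"
| "ap (EPerm a b c d e z) P4 = d"
| "ap (EPerm a b c d e z) P5 = e"

text \<open>The exponent of \<open>a\<close>, not the sign of the permutation.\<close>

fun par :: "eperm \<Rightarrow> bool" where
  "par (EPerm a b c d e z) = z"

text \<open>The projection onto $A_5$, kept inside the same type so that span computations also
  apply to projections.\<close>

fun fgt :: "eperm \<Rightarrow> eperm" where
  "fgt (EPerm a b c d e z) = EPerm a b c d e False"

fun pmul :: "eperm \<Rightarrow> eperm \<Rightarrow> eperm" where
  "pmul x (EPerm a b c d e z) = EPerm (ap x a) (ap x b) (ap x c) (ap x d) (ap x e) (par x \<noteq> z)"

definition pone :: eperm where
  "pone = EPerm P1 P2 P3 P4 P5 False"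

definition pa :: eperm where
  "pa = EPerm P1 P2 P3 P4 P5 True"

fun of_fun :: "(point \<Rightarrow> point) \<Rightarrow> eperm" where
  "of_fun f = EPerm (f P1) (f P2) (f P3) (f P4) (f P5) False"

fun pswap :: "point \<Rightarrow> point \<Rightarrow> point \<Rightarrow> point" where
  "pswap i j k = (if k = i then j else if k = j then i else k)"

definition pd :: "point \<Rightarrow> point \<Rightarrow> point \<Rightarrow> point \<Rightarrow> eperm" where
  "pd i j k l = pmul (of_fun (pswap i j)) (of_fun (pswap k l))"

definition pda :: "point \<Rightarrow> point \<Rightarrow> point \<Rightarrow> point \<Rightarrow> eperm" where
  "pda i j k l = pmul pa (pd i j k l)"

lemma eperm_eqI: "x = y" if "\<And>p. ap x p = ap y p" "par x = par y"
  using that(1)[of P1] that(1)[of P2] that(1)[of P3] that(1)[of P4] that(1)[of P5] that(2)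
  by (cases x; cases y) simp

lemma ap_pmul [simp]: "ap (pmul x y) p = ap x (ap y p)"
  by (cases y; cases p) simp_all

lemma par_pmul [simp]: "par (pmul x y) \<longleftrightarrow> par x \<noteq> par y"
  by (cases y) simp

lemma ap_pone [simp]: "ap pone p = p" and ap_pa [simp]: "ap pa p = p"
  by (cases p; simp add: pone_def pa_def)+

lemma par_pone [simp]: "\<not> par pone" and par_pa [simp]: "par pa"
  by (simp_all add: pone_def pa_def)

lemma ap_fgt [simp]: "ap (fgt x) p = ap x p" and par_fgt [simp]: "\<not> par (fgt x)"
  by (cases x; cases p; simp)+

text \<open>The type also contains non-bijective maps, so it is only a monoid as a whole;
  \<open>EG\<close> later cuts out the group.\<close>

lemma pmul_assoc: "pmul (pmul x y) z = pmul x (pmul y z)"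
  by (rule eperm_eqI) auto

lemma pmul_pone [simp]: "pmul pone x = x" "pmul x pone = x"
  by (rule eperm_eqI; simp)+

lemma pmul_pa_left_commute: "pmul x (pmul pa y) = pmul pa (pmul x y)"
  by (rule eperm_eqI) auto

lemma fgt_pmul [simp]: "fgt (pmul x y) = pmul (fgt x) (fgt y)"
  by (rule eperm_eqI) auto

lemma fgt_pone [simp]: "fgt pone = pone" and fgt_pa [simp]: "fgt pa = pone"
  by (simp_all add: pone_def pa_def)

lemma fgt_id: "\<not> par x \<Longrightarrow> fgt x = x"
  by (rule eperm_eqI) auto

lemma par_pd [simp]: "\<not> par (pd i j k l)"
  by (simp add: pd_def)

lemma fgt_pd [simp]: "fgt (pd i j k l) = pd i j k l"
  by (rule fgt_id) simp

declare pmul.simps [simp del] fgt.simps [simp del] of_fun.simps [simp del]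

definition adjoin :: "bool \<Rightarrow> eperm \<Rightarrow> eperm" where
  "adjoin z x = (if z then pmul pa x else x)"

lemma adjoin_par_fgt: "adjoin (par x) (fgt x) = x"
  by (rule eperm_eqI) (auto simp: adjoin_def)

lemma fgt_adjoin [simp]: "fgt (adjoin z x) = fgt x"
  and par_adjoin [simp]: "par (adjoin z x) \<longleftrightarrow> z \<noteq> par x"
  by (simp_all add: adjoin_def)

text \<open>Makes the number of unvisited elements a termination measure for
  \<open>reach\<close>.\<close>

lemma finite_eperm: "finite (UNIV :: eperm set)"
proof -
  have "(UNIV :: point set) = {P1, P2, P3, P4, P5}"
    using point.exhaust by auto
  hence "finite (UNIV :: point set)"
    by (metis finite.emptyI finite_insert)
  moreover have "(UNIV :: eperm set) = (\<lambda>(a, b, c, d, e, z). EPerm a b c d e z) ` UNIV"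
    by (auto simp: image_iff) (metis eperm.exhaust)
  ultimately show ?thesis
    by (metis finite_Prod_UNIV finite_class.finite_UNIV finite_imageI)
qed

subsection \<open>Generated subgroups\<close>

function reach :: "eperm list \<Rightarrow> eperm list \<Rightarrow> eperm list \<Rightarrow> eperm list" where
  "reach gs seen [] = seen"
| "reach gs seen (x # todo) =
    (if x \<in> set seen then reach gs seen todo else reach gs (x # seen) (map (pmul x) gs @ todo))"
  by pat_completeness auto
termination
  by (relation "measures [\<lambda>(gs, seen, todo). card (- set seen), \<lambda>(gs, seen, todo). length todo]")
    (auto intro!: psubset_card_mono finite_subset[OF _ finite_eperm])

definition pspan :: "eperm list \<Rightarrow> eperm list" where
  "pspan gs = reach gs [] [pone]"

lemma reach_superset: "set seen \<union> set todo \<subseteq> set (reach gs seen todo)"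
  by (induction gs seen todo rule: reach.induct) auto

text \<open>The invariant says that products of visited elements with generators are visited or
  waiting; with an empty stack it becomes closure.\<close>

lemma reach_closed:
  assumes "\<forall>x\<in>set seen. \<forall>g\<in>set gs. pmul x g \<in> set seen \<union> set todo"
  shows "\<forall>x\<in>set (reach gs seen todo). \<forall>g\<in>set gs. pmul x g \<in> set (reach gs seen todo)"
  using assms by (induction gs seen todo rule: reach.induct) (simp, force)

lemma reach_subset:
  assumes "\<And>x g. x \<in> A \<Longrightarrow> g \<in> set gs \<Longrightarrow> pmul x g \<in> A" "set seen \<union> set todo \<subseteq> A"
  shows "set (reach gs seen todo) \<subseteq> A"
  using assms by (induction gs seen todo rule: reach.induct) auto

lemma pone_in_pspan [simp]: "pone \<in> set (pspan gs)"
  using reach_superset[of "[]" "[pone]" gs] by (simp add: pspan_def)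

lemma pspan_pmul_gen: "x \<in> set (pspan gs) \<Longrightarrow> g \<in> set gs \<Longrightarrow> pmul x g \<in> set (pspan gs)"
  using reach_closed[of "[]" gs "[pone]"] by (simp add: pspan_def)

text \<open>Serves as the induction principle for \<open>pspan\<close>.\<close>

lemma pspan_subset:
  assumes "pone \<in> A" "\<And>x g. x \<in> A \<Longrightarrow> g \<in> set gs \<Longrightarrow> pmul x g \<in> A"
  shows "set (pspan gs) \<subseteq> A"
  unfolding pspan_def using assms by (intro reach_subset) auto

lemma gen_in_pspan: "g \<in> set gs \<Longrightarrow> g \<in> set (pspan gs)"
  using pspan_pmul_gen[of pone gs g] by simp

lemma pspan_pmul:
  assumes "x \<in> set (pspan gs)" "y \<in> set (pspan gs)"
  shows "pmul x y \<in> set (pspan gs)"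
proof -
  have "set (pspan gs) \<subseteq> {y. pmul x y \<in> set (pspan gs)}"
    using assms(1) by (intro pspan_subset) (auto simp: pmul_assoc[symmetric] pspan_pmul_gen)
  thus ?thesis using assms(2) by blast
qed

subsection \<open>The isomorphism\<close>

text \<open>The projections to $A_5$ of the generators of \<open>MM 1\<close>.\<close>

definition A5_gens :: "eperm list" where
  "A5_gens = [pd P1 P2 P3 P5, pd P1 P2 P3 P4, pd P1 P4 P2 P3]"

definition A5_list :: "eperm list" where
  "A5_list = pspan A5_gens"

definition EG :: "eperm monoid" where
  "EG = \<lparr> carrier = {x. fgt x \<in> set A5_list}, mult = pmul, one = pone \<rparr>"

lemma EG_simps [simp]: "x \<in> carrier EG \<longleftrightarrow> fgt x \<in> set A5_list" "mult EG = pmul" "one EG = pone"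
  by (simp_all add: EG_def)

lemma card_A5_list: "card (set A5_list) = 60"
  by code_simp

lemma fgt_A5_list:
  assumes "x \<in> set A5_list" shows "fgt x = x"
proof -
  have "set A5_list \<subseteq> {x. \<not> par x}"
    unfolding A5_list_def by (rule pspan_subset) (auto simp: A5_gens_def)
  thus ?thesis using assms by (auto intro: fgt_id)
qed

fun num :: "point \<Rightarrow> nat" where
  "num P1 = 1" | "num P2 = 2" | "num P3 = 3" | "num P4 = 4" | "num P5 = 5"

text \<open>\<open>P5\<close> is also the default outside \<open>{1..5}\<close>, where
  \<open>perm_of\<close> does not consult it.\<close>

definition pt :: "nat \<Rightarrow> point" where
  "pt n = (if n = 1 then P1 else if n = 2 then P2 else if n = 3 then P3 else if n = 4 then P4 else P5)"

text \<open>Elements of \<open>alt_group 5\<close> are functions on all naturals that fix everything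
  outside \<open>{1..5}\<close>; hence the second branch.\<close>

definition perm_of :: "eperm \<Rightarrow> nat \<Rightarrow> nat" where
  "perm_of x n = (if n \<in> {1..5} then num (ap x (pt n)) else n)"

definition dec :: "eperm \<Rightarrow> (nat \<Rightarrow> nat) \<times> int" where
  "dec x = (perm_of x, of_bool (par x))"

lemma pt_num [simp]: "pt (num p) = p"
  by (cases p) (simp_all add: pt_def)

lemma num_in [simp]: "num p \<in> {1..5}"
  by (cases p) simp_all

lemma num_eq_iff [simp]: "num p = num q \<longleftrightarrow> p = q"
  by (metis pt_num)

lemma num_pt: "n \<in> {1..5} \<Longrightarrow> num (pt n) = n"
  by (auto simp: pt_def)

lemma perm_of_pmul: "perm_of (pmul x y) = perm_of x \<circ> perm_of y"
  using num_in by (auto simp: perm_of_def fun_eq_iff simp del: atLeastAtMost_iff)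

lemma perm_of_eq_iff: "perm_of x = perm_of y \<longleftrightarrow> (\<forall>p. ap x p = ap y p)"
proof
  assume eq: "perm_of x = perm_of y"
  show "\<forall>p. ap x p = ap y p"
  proof
    fix p
    show "ap x p = ap y p"
      using fun_cong[OF eq, of "num p"] num_in[of p] by (simp add: perm_of_def del: num_in atLeastAtMost_iff)
  qed
qed (auto simp: perm_of_def fun_eq_iff)

lemma inj_dec: "inj dec"
  by (intro injI eperm_eqI) (auto simp: dec_def perm_of_eq_iff)

lemma perm_of_swap: "perm_of (of_fun (pswap i j)) = transpose (num i) (num j)"
proof
  fix n
  show "perm_of (of_fun (pswap i j)) n = transpose (num i) (num j) n"
  proof (cases "n \<in> {1..5}")
    case True
    then obtain p where n: "n = num p" by (metis num_pt)
    have "ap (of_fun f) p = f p" for f by (cases p) (simp_all add: of_fun.simps)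
    thus ?thesis
      using True by (auto simp: n perm_of_def transpose_def simp del: atLeastAtMost_iff)
  next
    case False
    thus ?thesis
      using num_in[of i] num_in[of j] by (auto simp: perm_of_def transpose_def simp del: num_in)
  qed
qed

lemma dec_pd: "dec (pd i j k l) = dt (num i) (num j) (num k) (num l)"
  by (simp add: dec_def dt_def) (simp add: pd_def perm_of_pmul perm_of_swap)

lemma dec_pda: "dec (pda i j k l) = dta (num i) (num j) (num k) (num l)"
proof -
  have "perm_of pa = id"
    by (auto simp: perm_of_def fun_eq_iff num_pt)
  thus ?thesis
    using dec_pd[of i j k l] by (simp add: dec_def pda_def dt_def dta_def perm_of_pmul)
qed

lemma group_A5Z2: "group A5Z2"
  unfolding A5Z2_def by (intro DirProd_group alt_group_is_group group_integer_mod_group)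

lemma dec_pmul: "dec (pmul x y) = dec x \<otimes>\<^bsub>A5Z2\<^esub> dec y"
  by (auto simp: dec_def A5Z2_def perm_of_pmul alt_group_mult)

lemma dec_pone: "dec pone = \<one>\<^bsub>A5Z2\<^esub>"
  by (auto simp: dec_def A5Z2_def alt_group_one perm_of_def fun_eq_iff num_pt)

lemma carrier_A5Z2: "carrier A5Z2 = carrier (alt_group 5) \<times> {0, 1}"
  by (auto simp: A5Z2_def carrier_integer_mod_group)

lemma card_carrier_A5Z2: "card (carrier A5Z2) = 120"
proof -
  have "2 * card (carrier (alt_group 5)) = 120"
    using alt_group_card_carrier[of 5] by (simp add: fact_numeral)
  thus ?thesis
    by (simp add: carrier_A5Z2 card_cartesian_product)
qed

lemma perm_of_pd_in_alt_group:
  assumes "i \<noteq> j" "k \<noteq> l" shows "perm_of (pd i j k l) \<in> carrier (alt_group 5)"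
proof -
  have "transpose (num i) (num j) \<circ> transpose (num k) (num l) permutes {1..5}"
    by (intro permutes_compose permutes_swap_id num_in)
  moreover have "evenperm (transpose (num i) (num j) \<circ> transpose (num k) (num l))"
    using assms by (simp add: evenperm_comp permutation_swap_id evenperm_swap)
  ultimately show ?thesis
    unfolding alt_group_carrier pd_def perm_of_pmul perm_of_swap by blast
qed

text \<open>The generators are even permutations, so the image lies in \<open>A5Z2\<close>; equality
  follows because both sets have 120 elements.\<close>

lemma dec_carrier: "dec ` carrier EG = carrier A5Z2"
proof (rule card_subset_eq)
  interpret alt: group "alt_group 5" by (rule alt_group_is_group)
  have id: "perm_of pone = id"
    by (auto simp: perm_of_def fun_eq_iff num_pt)
  have "set A5_list \<subseteq> {x. perm_of x \<in> carrier (alt_group 5)}"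
    unfolding A5_list_def
  proof (rule pspan_subset)
    show "pone \<in> {x. perm_of x \<in> carrier (alt_group 5)}"
      using alt.one_closed by (simp add: id alt_group_one)
    fix x g assume "x \<in> {x. perm_of x \<in> carrier (alt_group 5)}" "g \<in> set A5_gens"
    moreover from this have "perm_of g \<in> carrier (alt_group 5)"
      by (auto simp: A5_gens_def intro!: perm_of_pd_in_alt_group)
    ultimately show "pmul x g \<in> {x. perm_of x \<in> carrier (alt_group 5)}"
      using alt.m_closed[of "perm_of x" "perm_of g"] by (simp add: perm_of_pmul alt_group_mult)
  qed
  moreover have "perm_of (fgt x) = perm_of x" for x
    by (simp add: perm_of_eq_iff)
  ultimately show "dec ` carrier EG \<subseteq> carrier A5Z2"
    by (auto simp: dec_def carrier_A5Z2)
  have "\<not> par x" if "x \<in> set A5_list" for x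
    using that by (metis fgt_A5_list par_fgt)
  hence "bij_betw (\<lambda>(x, z). adjoin z x) (set A5_list \<times> UNIV) (carrier EG)"
    by (intro bij_betw_byWitness[where f' = "\<lambda>x. (fgt x, par x)"])
      (auto simp: adjoin_par_fgt fgt_A5_list)
  hence "card (carrier EG) = card (set A5_list \<times> (UNIV :: bool set))"
    by (simp add: bij_betw_same_card)
  hence "card (carrier EG) = 120"
    by (simp add: card_cartesian_product card_A5_list)
  thus "card (dec ` carrier EG) = card (carrier A5Z2)"
    by (simp add: card_carrier_A5Z2 card_image inj_on_subset[OF inj_dec])
  show "finite (carrier A5Z2)"
    using card_carrier_A5Z2 by (metis card.infinite zero_neq_numeral)
qed

lemma dec_mem_iff: "dec x \<in> carrier A5Z2 \<longleftrightarrow> x \<in> carrier EG"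
  using inj_dec by (metis dec_carrier inj_image_mem_iff)

text \<open>Closure and inverses are pulled back along the injective \<open>dec\<close>: an inverse
  in \<open>EG\<close> is the preimage of one in \<open>A5Z2\<close>.\<close>

lemma group_EG: "group EG"
proof -
  interpret group A5Z2 by (rule group_A5Z2)
  show ?thesis
  proof (rule groupI)
    fix x y assume "x \<in> carrier EG" "y \<in> carrier EG"
    hence "dec x \<otimes>\<^bsub>A5Z2\<^esub> dec y \<in> carrier A5Z2"
      by (intro m_closed) (simp_all add: dec_mem_iff)
    thus "x \<otimes>\<^bsub>EG\<^esub> y \<in> carrier EG"
      by (metis EG_simps(2) dec_mem_iff dec_pmul)
  next
    fix x assume "x \<in> carrier EG"
    hence x: "dec x \<in> carrier A5Z2"
      by (simp add: dec_mem_iff)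
    then obtain y where y: "y \<in> carrier EG" "dec y = inv\<^bsub>A5Z2\<^esub> dec x"
      using inv_closed dec_carrier by (metis imageE)
    hence "dec (pmul y x) = dec pone"
      using x by (simp add: dec_pmul dec_pone)
    thus "\<exists>y\<in>carrier EG. y \<otimes>\<^bsub>EG\<^esub> x = \<one>\<^bsub>EG\<^esub>"
      using y(1) inj_dec by (metis EG_simps(2,3) injD)
  next
    have "dec pone \<in> carrier A5Z2"
      by (simp add: dec_pone)
    thus "\<one>\<^bsub>EG\<^esub> \<in> carrier EG"
      by (metis EG_simps(3) dec_mem_iff)
  qed (simp_all add: pmul_assoc)
qed

lemma dec_iso: "dec \<in> iso EG A5Z2"
  using dec_carrier inj_dec
  by (auto simp: iso_def hom_def bij_betw_def dec_pmul dec_mem_iff[symmetric] simp del: EG_simps(1)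
      intro: inj_on_subset)

lemma finite_carrier_EG: "finite (carrier EG)"
  using finite_eperm by (rule finite_subset[rotated]) simp

section \<open>Deciding linearity\<close>

text \<open>\<open>H\<close> and \<open>K\<close> list the two subgroups. The first clause is for
  the intersection condition, the second for the product condition.\<close>

definition linear_gens :: "eperm list \<Rightarrow> eperm list \<Rightarrow> eperm \<Rightarrow> bool" where
  "linear_gens H K r2 \<longleftrightarrow>
    (\<forall>x\<in>set H. x \<notin> set K \<or> x = pone \<or> x = r2) \<and>
    (\<forall>h\<in>set H. h \<in> set K \<or> (\<forall>k\<in>set K. k \<in> set H \<or> (\<forall>k'\<in>set K. pmul k' (pmul h k) \<notin> set H)))"

text \<open>\<open>pspan\<close> multiplies by generators only; inverses come for free because each
  generator is its own inverse.\<close>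

lemma generate_EG:
  assumes "\<And>g. g \<in> set gs \<Longrightarrow> g \<in> carrier EG" "\<And>g. g \<in> set gs \<Longrightarrow> pmul g g = pone"
  shows "generate EG (set gs) = set (pspan gs)"
proof
  interpret group EG by (rule group_EG)
  show "generate EG (set gs) \<subseteq> set (pspan gs)"
  proof
    fix x assume "x \<in> generate EG (set gs)"
    thus "x \<in> set (pspan gs)"
    proof induction
      case (inv h)
      hence "inv\<^bsub>EG\<^esub> h = h"
        using assms by (intro inv_equality) auto
      thus ?case using inv by (simp add: gen_in_pspan)
    qed (auto simp: gen_in_pspan pspan_pmul)
  qed
  show "set (pspan gs) \<subseteq> generate EG (set gs)"
    by (rule pspan_subset) (use generate.one[of EG] generate.eng[of _ EG] generate.incl[of _ _ EG] in auto)
qed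

lemma linear_gens_iff:
  assumes r: "involution EG r0" "involution EG r1" "involution EG r2"
  defines "H \<equiv> generate EG {r1, r2}" and "K \<equiv> generate EG {r0, r2}"
  shows "H \<inter> K = generate EG {r2} \<and> (H <#>\<^bsub>EG\<^esub> K) \<inter> (K <#>\<^bsub>EG\<^esub> H) = H \<union> K
    \<longleftrightarrow> linear_gens (pspan [r1, r2]) (pspan [r0, r2]) r2"
proof -
  interpret group EG by (rule group_EG)
  have r': "r \<in> carrier EG" "pmul r r = pone" if "r \<in> {r0, r1, r2}" for r
    using r that by (auto simp: involution_def)
  have H: "H = set (pspan [r1, r2])" and K: "K = set (pspan [r0, r2])"
    and C: "generate EG {r2} = set (pspan [r2])"
    unfolding H_def K_def using generate_EG[of "[r1, r2]"] generate_EG[of "[r0, r2]"] generate_EG[of "[r2]"] r'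
    by auto
  have "set (pspan [r2]) \<subseteq> {pone, r2}"
    by (rule pspan_subset) (use r' in auto)
  hence C': "generate EG {r2} = {pone, r2}"
    using gen_in_pspan[of r2 "[r2]"] by (auto simp: C)
  have sub: "subgroup H EG" "subgroup K EG"
    unfolding H_def K_def by (intro generate_is_subgroup; use r' in force)+
  \<comment> \<open>These memberships give one inclusion of the intersection condition and leave the
    one that \<open>linear_gens\<close> tests.\<close>
  have "pone \<in> H" "pone \<in> K" "r2 \<in> H" "r2 \<in> K"
    by (simp_all add: H K gen_in_pspan)
  hence cap: "H \<inter> K = generate EG {r2} \<longleftrightarrow> (\<forall>x\<in>H. x \<notin> K \<or> x = pone \<or> x = r2)"
    unfolding C' by blast
  show ?thesis
    unfolding cap set_mult_Int_set_mult_eq_Un_iff[OF sub] linear_gens_def H[symmetric] K[symmetric]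
    by auto
qed

text \<open>The projection of a generating set to $A_5$ generates $A_5$, so it does not lie in a
  subgroup with fewer than 60 elements.\<close>

lemma pspan_too_small:
  assumes gen: "generate EG {r0, r1, r2} = carrier EG"
    and r: "involution EG r0" "involution EG r1" "involution EG r2"
    and sub: "fgt r0 \<in> set (pspan hs)" "fgt r1 \<in> set (pspan hs)" "fgt r2 \<in> set (pspan hs)"
  shows "\<not> length (pspan hs) < 60"
proof -
  have "carrier EG = set (pspan [r0, r1, r2])"
    using gen generate_EG[of "[r0, r1, r2]"] r by (auto simp: involution_def)
  moreover have "set (pspan [r0, r1, r2]) \<subseteq> {x. fgt x \<in> set (pspan hs)}"
    by (rule pspan_subset) (use sub in \<open>auto simp: pspan_pmul\<close>)
  moreover have "x \<in> carrier EG" "fgt x = x" if "x \<in> set A5_list" for x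
    using that fgt_A5_list by simp_all
  ultimately have "set A5_list \<subseteq> set (pspan hs)"
    by (metis (no_types, lifting) mem_Collect_eq subsetD subsetI)
  hence "60 \<le> card (set (pspan hs))"
    using card_A5_list by (metis card_mono finite_set)
  \<comment> \<open>Repeated entries could only make \<open>length\<close> larger, so
    \<open>length (pspan hs) < 60\<close> is a safe test.\<close>
  thus ?thesis
    using card_length[of "pspan hs"] by linarith
qed

text \<open>If no generator has the factor \<open>a\<close>, all products have exponent 0 and
  \<open>pa\<close> is missed.\<close>

lemma generating_imp_par:
  assumes gen: "generate EG {r0, r1, r2} = carrier EG"
    and r: "involution EG r0" "involution EG r1" "involution EG r2"
  shows "par r0 \<or> par r1 \<or> par r2"
proof (rule ccontr)
  assume *: "\<not> (par r0 \<or> par r1 \<or> par r2)"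
  have "carrier EG = set (pspan [r0, r1, r2])"
    using gen generate_EG[of "[r0, r1, r2]"] r by (auto simp: involution_def)
  moreover have "set (pspan [r0, r1, r2]) \<subseteq> {x. \<not> par x}"
    by (rule pspan_subset) (use * in auto)
  moreover have "pa \<in> carrier EG"
    by (simp add: A5_list_def)
  ultimately show False by auto
qed

section \<open>Conjugation by elements of $S_5$\<close>

fun preimage :: "eperm \<Rightarrow> point \<Rightarrow> point" where
  "preimage x p = (if ap x P1 = p then P1 else if ap x P2 = p then P2 else if ap x P3 = p then P3
    else if ap x P4 = p then P4 else P5)"

text \<open>A genuine inverse only for bijective \<open>x\<close> with exponent 0;
  \<open>S5_list_pinv\<close> verifies the cases in use.\<close>

definition pinv :: "eperm \<Rightarrow> eperm" where
  "pinv x = of_fun (preimage x)"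

definition pconj :: "eperm \<Rightarrow> eperm \<Rightarrow> eperm" where
  "pconj s x = pmul s (pmul x (pinv s))"

text \<open>The two cosets of $A_5$ in $S_5$. The odd elements lie outside \<open>EG\<close>, yet
  conjugation by them preserves it.\<close>

definition S5_list :: "eperm list" where
  "S5_list = A5_list @ map (pmul (of_fun (pswap P1 P2))) A5_list"

lemma S5_list_pinv: "\<forall>s\<in>set S5_list. pmul (pinv s) s = pone \<and> pmul s (pinv s) = pone"
  by code_simp

text \<open>Checking generators of $A_5$ suffices, since conjugation is multiplicative.\<close>

lemma S5_list_conj: "\<forall>s\<in>set S5_list. \<forall>g\<in>set A5_gens. pconj s g \<in> set A5_list"
  by code_simp

text \<open>\<open>pa\<close> is central, so conjugation leaves exponents alone and a triple can be
  normalised through its projections.\<close>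

lemma pconj_adjoin: "pconj s (adjoin z x) = adjoin z (pconj s x)"
  by (simp add: pconj_def adjoin_def pmul_assoc pmul_pa_left_commute)

lemma pconj_iso:
  assumes s: "s \<in> set S5_list" shows "pconj s \<in> iso EG EG"
proof -
  have inv: "pmul (pinv s) s = pone" "pmul s (pinv s) = pone"
    and gen: "\<And>g. g \<in> set A5_gens \<Longrightarrow> pconj s g \<in> set A5_list"
    using S5_list_pinv S5_list_conj s by auto
  have inv': "pmul (pinv s) (pmul s x) = x" for x
    by (simp add: inv flip: pmul_assoc)
  have mul: "pconj s (pmul x y) = pmul (pconj s x) (pconj s y)" for x y
    by (simp add: pconj_def pmul_assoc inv')
  have pone: "pconj s pone = pone"
    by (simp add: pconj_def inv)
  have A5: "set A5_list \<subseteq> {x. pconj s x \<in> set A5_list}"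
    unfolding A5_list_def
    by (rule pspan_subset) (use gen pone in \<open>auto simp: mul pspan_pmul A5_list_def\<close>)
  have closed: "pconj s ` carrier EG \<subseteq> carrier EG"
  proof clarsimp
    fix x assume "fgt x \<in> set A5_list"
    hence "pconj s (fgt x) \<in> set A5_list" using A5 by blast
    moreover have "fgt (pconj s x) = fgt (pconj s (fgt x))"
      by (rule eperm_eqI) (auto simp: pconj_def)
    ultimately show "fgt (pconj s x) \<in> set A5_list"
      by (simp add: fgt_A5_list)
  qed
  have inj: "inj (pconj s)"
  proof (rule injI)
    fix x y assume "pconj s x = pconj s y"
    hence "pmul (pmul (pinv s) (pconj s x)) s = pmul (pmul (pinv s) (pconj s y)) s" by simp
    thus "x = y" by (simp add: pconj_def inv' pmul_assoc inv)
  qed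
  have "pconj s ` carrier EG = carrier EG"
    using closed finite_carrier_EG inj by (meson endo_inj_surj inj_on_subset subset_UNIV)
  thus ?thesis
    using inj by (auto simp: iso_def hom_def bij_betw_def mul intro: inj_on_subset)
qed

section \<open>The classification\<close>

text \<open>The fifteen double transpositions, grouped by their fixed points 5, 4, 3, 2, 1.\<close>

definition involutions :: "eperm list" where
  "involutions =
    [pd P1 P2 P3 P4, pd P1 P3 P2 P4, pd P1 P4 P2 P3, pd P1 P2 P3 P5, pd P1 P3 P2 P5, pd P1 P5 P2 P3,
     pd P1 P2 P4 P5, pd P1 P4 P2 P5, pd P1 P5 P2 P4, pd P1 P3 P4 P5, pd P1 P4 P3 P5, pd P1 P5 P3 P4,
     pd P2 P3 P4 P5, pd P2 P4 P3 P5, pd P2 P5 P3 P4]"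

lemma A5_list_involutions:
  "\<forall>x\<in>set A5_list. pmul x x \<noteq> pone \<or> x \<in> set (pone # involutions)"
  by code_simp

text \<open>The entry \<open>pone\<close> accounts for the involution \<open>a\<close>
  itself.\<close>

lemma fgt_involution:
  assumes "involution EG x" shows "fgt x \<in> set (pone # involutions)"
proof -
  have "pmul (fgt x) (fgt x) = pone"
    using assms by (metis EG_simps(2,3) fgt_pmul fgt_pone involution_def)
  thus ?thesis
    using assms A5_list_involutions by (auto simp: involution_def)
qed

text \<open>Two involutions generate at most a dihedral group, never $A_5$.\<close>

lemma pspan_two_involutions:
  "\<forall>p\<in>set (pone # involutions). \<forall>q\<in>set (pone # involutions). length (pspan [p, q]) < 60"
  by code_simp

text \<open>Position \<open>i - 1\<close> corresponds to \<open>MM i\<close>.\<close>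

definition reps :: "(eperm \<times> eperm \<times> eperm) list" where
  "reps =
   [(pd  P1 P2 P3 P5, pda P1 P2 P3 P4, pd  P1 P4 P2 P3),
    (pd  P1 P2 P3 P5, pda P1 P3 P2 P4, pd  P1 P4 P2 P3),
    (pda P1 P2 P3 P5, pda P1 P2 P3 P4, pda P1 P3 P2 P4),
    (pda P1 P2 P3 P5, pda P1 P3 P2 P4, pda P1 P2 P3 P4),
    (pda P1 P2 P3 P5, pd  P1 P4 P2 P3, pda P1 P2 P3 P4),
    (pda P1 P4 P2 P5, pda P1 P2 P3 P4, pda P1 P3 P2 P4),
    (pda P1 P2 P3 P5, pd  P1 P4 P2 P3, pda P1 P3 P2 P4),
    (pd  P1 P4 P2 P5, pda P1 P2 P3 P4, pd  P1 P4 P2 P3),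
    (pda P1 P4 P2 P5, pd  P1 P4 P2 P3, pda P1 P2 P3 P4),
    (pda P1 P4 P3 P5, pd  P1 P2 P4 P5, pd  P1 P3 P4 P5),
    (pda P1 P4 P3 P5, pda P1 P2 P4 P5, pda P1 P3 P4 P5),
    (pda P1 P3 P2 P4, pda P1 P2 P4 P5, pda P1 P3 P4 P5),
    (pd  P1 P4 P3 P5, pda P1 P2 P4 P5, pda P1 P3 P4 P5),
    (pda P1 P4 P3 P5, pd  P1 P4 P2 P3, pd  P1 P3 P4 P5),
    (pda P1 P5 P3 P4, pd  P1 P4 P2 P3, pd  P1 P3 P4 P5),
    (pda P1 P4 P3 P5, pda P1 P4 P2 P3, pda P1 P3 P4 P5),
    (pda P1 P5 P3 P4, pda P1 P4 P2 P3, pda P1 P3 P4 P5),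
    (pd  P1 P4 P3 P5, pda P1 P4 P2 P3, pda P1 P3 P4 P5),
    (pd  P1 P5 P3 P4, pda P1 P4 P2 P3, pda P1 P3 P4 P5)]"

lemma length_reps: "length reps = 19"
  by (simp add: reps_def)

lemma reps_fgt: "\<forall>x\<in>set (concat (map (\<lambda>(r0, r1, r2). [r0, r1, r2]) reps)). fgt x \<in> set A5_list"
  by code_simp

lemma reps_in_carrier:
  assumes "(r0, r1, r2) \<in> set reps"
  shows "r0 \<in> carrier EG" "r1 \<in> carrier EG" "r2 \<in> carrier EG"
  using assms reps_fgt by force+

lemma MM_eq_reps:
  assumes "i \<in> {1..19}"
  shows "MM i = (case reps ! (i - 1) of (r0, r1, r2) \<Rightarrow> Hypermap A5Z2 (dec r0) (dec r1) (dec r2))"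
proof -
  have "MM i = map (\<lambda>(r0, r1, r2). Hypermap A5Z2 (dec r0) (dec r1) (dec r2)) reps ! (i - 1)"
    by (simp add: MM_def reps_def dec_pd dec_pda)
  moreover have "i - 1 < length reps"
    using assms by (auto simp: length_reps)
  ultimately show ?thesis by simp
qed

text \<open>Up to conjugation in $S_5$, there are three pairs of distinct involutions of $A_5$; the
  order of the product is 2, 3 or 5.\<close>

definition second_gens :: "eperm list" where
  "second_gens = [pd P1 P3 P2 P4, pd P1 P2 P3 P5, pd P1 P5 P2 P3]"

lemma pconj_pair:
  "\<forall>p1\<in>set involutions. \<forall>p2\<in>set involutions.
    \<exists>s\<in>set S5_list. p1 = p2 \<or> pconj s p2 = pd P1 P2 P3 P4 \<and> pconj s p1 \<in> set second_gens"
  by code_simp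

text \<open>The conjugates of listed triples that have the normal form of the search. As
  \<open>s\<close> runs through all of $S_5$, conjugates under the stabilizer of a normalised pair
  are included.\<close>

definition normalized_conjs :: "(eperm \<times> eperm \<times> eperm) list" where
  "normalized_conjs = concat (map (\<lambda>(r0, r1, r2). concat (map (\<lambda>s.
     if fgt (pconj s r2) = pd P1 P2 P3 P4 \<and> fgt (pconj s r1) \<in> set second_gens
     then [(pconj s r0, pconj s r1, pconj s r2)] else []) S5_list)) reps)"

text \<open>The lists \<open>R\<close> (the conjugates of \<open>reps\<close> above) and \<open>H\<close> are arguments so that the simplifier
  evaluates them only once; the argument patterns keep it from unfolding under binders.\<close>

fun settled :: "(eperm \<times> eperm \<times> eperm) list \<Rightarrow> eperm list \<Rightarrow> eperm \<Rightarrow> eperm \<Rightarrow> eperm \<Rightarrow> bool" where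
  "settled R H r1 r2 (EPerm a b c d e z) \<longleftrightarrow>
    \<not> linear_gens H (pspan [EPerm a b c d e z, r2]) r2 \<or> (EPerm a b c d e z, r1, r2) \<in> set R \<or>
    length (pspan [EPerm a b c d e False, fgt r1, fgt r2]) < 60"

fun all_settled :: "(eperm \<times> eperm \<times> eperm) list \<Rightarrow> eperm list \<Rightarrow> eperm \<Rightarrow> eperm \<Rightarrow> bool" where
  "all_settled R H r1 (EPerm a b c d e z) \<longleftrightarrow>
    (\<forall>p0\<in>set (pone # involutions). \<forall>e0\<in>set [False, True].
      \<not> e0 \<and> \<not> par r1 \<and> \<not> z \<or> settled R H r1 (EPerm a b c d e z) (adjoin e0 p0))"

lemma settled_iff:
  "settled R H r1 r2 r0 \<longleftrightarrow> \<not> linear_gens H (pspan [r0, r2]) r2 \<or> (r0, r1, r2) \<in> set R \<or>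
    length (pspan [fgt r0, fgt r1, fgt r2]) < 60"
  by (cases r0) (simp add: fgt.simps)

lemma all_settled_iff:
  "all_settled R H r1 r2 \<longleftrightarrow> (\<forall>p0\<in>set (pone # involutions). \<forall>e0\<in>set [False, True].
      \<not> e0 \<and> \<not> par r1 \<and> \<not> par r2 \<or> settled R H r1 r2 (adjoin e0 p0))"
  by (cases r2) simp

text \<open>Twelve pairs \<open>(r1, r2)\<close> with 32 choices of \<open>r0\<close> each. A choice
  has no factor \<open>a\<close>, fails linearity, is in the table, or has projections that generate
  too little.\<close>

lemma all_settled_normalized:
  "\<forall>p1\<in>set second_gens. \<forall>e1\<in>set [False, True]. \<forall>e2\<in>set [False, True].
    all_settled normalized_conjs (pspan [adjoin e1 p1, adjoin e2 (pd P1 P2 P3 P4)])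
      (adjoin e1 p1) (adjoin e2 (pd P1 P2 P3 P4))"
  by code_simp

lemma regular_linear_hypermap_EG_classified:
  assumes M: "regular_linear_hypermap (Hypermap EG r0 r1 r2)"
  shows "\<exists>i<19. \<exists>\<phi>\<in>iso EG EG. reps ! i = (\<phi> r0, \<phi> r1, \<phi> r2)"
proof -
  interpret group EG by (rule group_EG)
  have inv: "involution EG r0" "involution EG r1" "involution EG r2"
    and gen: "generate EG {r0, r1, r2} = carrier EG"
    using M by (auto simp: regular_linear_hypermap_def Let_def)
  note small = pspan_too_small[OF gen inv]
  define p0 p1 p2 where p: "p0 = fgt r0" "p1 = fgt r1" "p2 = fgt r2"
  have mem: "p0 \<in> set (pone # involutions)" "p1 \<in> set (pone # involutions)" "p2 \<in> set (pone # involutions)"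
    unfolding p using fgt_involution inv by blast+
  \<comment> \<open>If one projection lay in the span of the other two, those two would generate
    $A_5$. Hence \<open>p1\<close> and \<open>p2\<close> are nontrivial and distinct.\<close>
  have two: "p1 \<notin> set (pspan [p0, p2])" "p2 \<notin> set (pspan [p0, p1])"
    using small[of "[p0, p2]"] small[of "[p0, p1]"] pspan_two_involutions mem
    by (auto simp: p gen_in_pspan)
  have "p1 \<noteq> pone" "p2 \<noteq> pone" "p1 \<noteq> p2"
    using two gen_in_pspan[of p2 "[p0, p2]"] by auto
  then obtain s where s: "s \<in> set S5_list" "pconj s p2 = pd P1 P2 P3 P4" "pconj s p1 \<in> set second_gens"
    using pconj_pair mem by auto
  define q where "q = pconj s"
  have q: "q \<in> iso EG EG"
    unfolding q_def by (rule pconj_iso) fact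
  have M': "regular_linear_hypermap (Hypermap EG (q r0) (q r1) (q r2))"
    by (rule regular_linear_hypermap_iso[OF group_EG group_EG q M])
  hence inv': "involution EG (q r0)" "involution EG (q r1)" "involution EG (q r2)"
    and gen': "generate EG {q r0, q r1, q r2} = carrier EG"
    by (auto simp: regular_linear_hypermap_def Let_def)
  have lin: "linear_gens (pspan [q r1, q r2]) (pspan [q r0, q r2]) (q r2)"
    using M' linear_gens_iff[OF inv'] by (simp add: regular_linear_hypermap_def Let_def)
  have q1: "q r1 = adjoin (par r1) (pconj s p1)" and q2: "q r2 = adjoin (par r2) (pd P1 P2 P3 P4)"
    unfolding q_def s(2)[symmetric] by (simp_all add: p adjoin_par_fgt flip: pconj_adjoin)
  have q0: "fgt (q r0) \<in> set (pone # involutions)"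
    by (rule fgt_involution[OF inv'(1)])
  have "all_settled normalized_conjs (pspan [q r1, q r2]) (q r1) (q r2)"
    using all_settled_normalized s(3) by (cases "par r1"; cases "par r2") (simp_all add: q1 q2)
  hence "\<not> par (q r0) \<and> \<not> par (q r1) \<and> \<not> par (q r2)
      \<or> settled normalized_conjs (pspan [q r1, q r2]) (q r1) (q r2) (adjoin (par (q r0)) (fgt (q r0)))"
    using q0 unfolding all_settled_iff by (metis (full_types) list.set_intros(1,2))
  hence "settled normalized_conjs (pspan [q r1, q r2]) (q r1) (q r2) (q r0)"
    using generating_imp_par[OF gen' inv'] by (auto simp: adjoin_par_fgt)
  moreover have "\<not> length (pspan [fgt (q r0), fgt (q r1), fgt (q r2)]) < 60"
    by (rule pspan_too_small[OF gen' inv']) (auto intro: gen_in_pspan)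
  ultimately have "(q r0, q r1, q r2) \<in> set normalized_conjs"
    using lin by (simp add: settled_iff)
  then obtain t0 t1 t2 s' where t: "(t0, t1, t2) \<in> set reps" "s' \<in> set S5_list"
      "pconj s' t0 = q r0" "pconj s' t1 = q r1" "pconj s' t2 = q r2"
    unfolding normalized_conjs_def by (auto split: if_splits)
  from t(1) obtain i where i: "i < 19" "reps ! i = (t0, t1, t2)"
    by (metis in_set_conv_nth length_reps)
  have tc: "t0 \<in> carrier EG \<and> t1 \<in> carrier EG \<and> t2 \<in> carrier EG"
    using t(1) reps_in_carrier by auto
  \<comment> \<open>Conjugation by \<open>s\<close> reaches the normal form; undoing the conjugation
    by \<open>s'\<close> then lands on the listed triple \<open>(t0, t1, t2)\<close>.\<close>
  define \<phi> where "\<phi> = inv_into (carrier EG) (pconj s') \<circ> q"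
  have c': "pconj s' \<in> iso EG EG"
    by (rule pconj_iso) fact
  have "\<phi> \<in> iso EG EG"
    unfolding \<phi>_def by (rule iso_set_trans[OF q iso_set_sym[OF c']])
  moreover have "inj_on (pconj s') (carrier EG)"
    using c' by (auto simp: iso_def bij_betw_def)
  hence "\<phi> r0 = t0" "\<phi> r1 = t1" "\<phi> r2 = t2"
    unfolding \<phi>_def comp_def t(3-)[symmetric] using tc by (simp_all add: inv_into_f_f del: EG_simps)
  ultimately show ?thesis
    using i by blast
qed

section \<open>The nineteen hypermaps\<close>

definition value_of :: "eperm list \<Rightarrow> nat list \<Rightarrow> eperm" where
  "value_of rs = foldl (\<lambda>x i. pmul x (rs ! i)) pone"

text \<open>Element orders divide 6 or 10, so the second, third, fifth and sixth powers of a nontrivial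
  element determine its order.\<close>

definition words :: "nat list list" where
  "words = [[0, 1], [0, 2], [1, 2], [0, 1, 2]]"

definition relators :: "nat list list" where
  "relators = concat (map (\<lambda>u. map (\<lambda>n. concat (replicate n u)) [2, 3, 5, 6]) words)"

lemma value_of_in_pspan:
  assumes "set ws \<subseteq> {..<length rs}" shows "value_of rs ws \<in> set (pspan rs)"
proof -
  have "foldl (\<lambda>x i. pmul x (rs ! i)) x ws \<in> set (pspan rs)" if "x \<in> set (pspan rs)" for x
    using assms that by (induction ws arbitrary: x) (auto simp: pspan_pmul_gen)
  thus ?thesis by (simp add: value_of_def)
qed

lemma walk_A5Z2:
  assumes "set ws \<subseteq> {..<3}"
  shows "walk (Hypermap A5Z2 (dec r0) (dec r1) (dec r2)) \<one>\<^bsub>A5Z2\<^esub> ws = dec (value_of [r0, r1, r2] ws)"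
proof -
  have "gens (Hypermap A5Z2 (dec r0) (dec r1) (dec r2)) ! i = dec ([r0, r1, r2] ! i)" if "i < 3" for i
    using that by (auto simp: gens_def less_Suc_eq numeral_3_eq_3)
  \<comment> \<open>The starting flag is arbitrary because it changes along the word.\<close>
  hence "walk (Hypermap A5Z2 (dec r0) (dec r1) (dec r2)) (dec x) ws
      = dec (foldl (\<lambda>x i. pmul x ([r0, r1, r2] ! i)) x ws)" for x
    using assms by (induction ws arbitrary: x) (auto simp: walk_def simp flip: dec_pmul)
  thus ?thesis
    by (simp add: value_of_def flip: dec_pone)
qed

text \<open>In each of the 19 triples, one of \<open>words\<close> evaluates to $pa$ with $p$ of order 3 or 5, so its
  15th power is $a$. With the projection onto $A_5$ surjective, this shows that the triple generates.
  Here and in \<open>signature\<close>, matching on the triple delays unfolding until all entries are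
  known.\<close>

fun linear_triple :: "eperm \<times> eperm \<times> eperm \<Rightarrow> bool" where
  "linear_triple (r0, r1, r2) \<longleftrightarrow>
    (\<forall>r\<in>set [r0, r1, r2]. r \<noteq> pone \<and> pmul r r = pone) \<and> distinct [r0, r1, r2] \<and>
    linear_gens (pspan [r1, r2]) (pspan [r0, r2]) r2 \<and>
    card (set (pspan [fgt r0, fgt r1, fgt r2])) = 60 \<and>
    (\<exists>u\<in>set words. value_of [r0, r1, r2] (concat (replicate 15 u)) = pa)"

lemma linear_triple_reps: "\<forall>t\<in>set reps. linear_triple t"
  by code_simp

lemma regular_linear_hypermap_reps:
  assumes mem: "(r0, r1, r2) \<in> set reps"
  shows "regular_linear_hypermap (Hypermap EG r0 r1 r2)"
proof -
  note car = reps_in_carrier[OF mem]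
  have r: "r0 \<noteq> pone" "r1 \<noteq> pone" "r2 \<noteq> pone" "pmul r0 r0 = pone" "pmul r1 r1 = pone" "pmul r2 r2 = pone"
    and ne: "r0 \<noteq> r1" "r0 \<noteq> r2" "r1 \<noteq> r2"
    and lin: "linear_gens (pspan [r1, r2]) (pspan [r0, r2]) r2"
    and card: "card (set (pspan [fgt r0, fgt r1, fgt r2])) = 60"
    and "\<exists>u\<in>set words. value_of [r0, r1, r2] (concat (replicate 15 u)) = pa"
    using mem linear_triple_reps by auto
  then obtain u where u: "u \<in> set words" "value_of [r0, r1, r2] (concat (replicate 15 u)) = pa" by blast
  have inv: "involution EG r0" "involution EG r1" "involution EG r2"
    using car r by (auto simp: involution_def)
  let ?S = "set (pspan [r0, r1, r2])"
  have gen: "generate EG {r0, r1, r2} = ?S"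
    using generate_EG[of "[r0, r1, r2]"] car r by auto
  have "set (concat (replicate 15 u)) \<subseteq> {..<length [r0, r1, r2]}"
    using u(1) by (auto simp: words_def)
  hence pa: "pa \<in> ?S"
    using value_of_in_pspan u(2) by metis
  have "set (pspan [fgt r0, fgt r1, fgt r2]) \<subseteq> set A5_list"
    unfolding A5_list_def by (rule pspan_subset) (use car in \<open>auto simp: A5_list_def pspan_pmul\<close>)
  hence A5: "set (pspan [fgt r0, fgt r1, fgt r2]) = set A5_list"
    using card card_A5_list by (metis card_subset_eq finite_set)
  \<comment> \<open>The span maps onto $A_5$. Each fibre of \<open>fgt\<close> is
    \<open>{y, pmul y pa}\<close>, so with \<open>pa\<close> in the span all of \<open>EG\<close> is
    reached.\<close>
  have onto: "set (pspan [fgt r0, fgt r1, fgt r2]) \<subseteq> fgt ` ?S"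
  proof (rule pspan_subset)
    show "pone \<in> fgt ` ?S"
      using pone_in_pspan by (metis fgt_pone imageI)
    fix x g assume "x \<in> fgt ` ?S" "g \<in> set [fgt r0, fgt r1, fgt r2]"
    then obtain y r where "y \<in> ?S" "x = fgt y" "r \<in> set [r0, r1, r2]" "g = fgt r" by auto
    moreover from this have "pmul y r \<in> ?S" by (intro pspan_pmul_gen)
    ultimately show "pmul x g \<in> fgt ` ?S" by (metis fgt_pmul imageI)
  qed
  have "carrier EG \<subseteq> ?S"
  proof
    fix x assume "x \<in> carrier EG"
    hence "fgt x \<in> fgt ` ?S"
      using onto unfolding A5 EG_simps(1) by blast
    then obtain y where y: "y \<in> ?S" "fgt x = fgt y" by (elim imageE)
    have ap: "ap x p = ap y p" for p
      using y(2) by (metis ap_fgt)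
    have "x = y \<or> x = pmul y pa"
    proof (cases "par x = par y")
      case True
      have "x = y" by (rule eperm_eqI[OF ap True])
      thus ?thesis ..
    next
      case False
      hence "x = pmul y pa" by (intro eperm_eqI) (auto simp: ap)
      thus ?thesis ..
    qed
    thus "x \<in> ?S" using y(1) pa pspan_pmul by auto
  qed
  moreover have "generate EG {r0, r1, r2} \<subseteq> carrier EG"
    by (rule group.generate_incl[OF group_EG]) (use car in auto)
  ultimately have "generate EG {r0, r1, r2} = carrier EG"
    unfolding gen by blast
  thus ?thesis
    using linear_gens_iff[OF inv] lin inv ne group_EG finite_carrier_EG
    by (simp add: regular_linear_hypermap_def Let_def)
qed

section \<open>Telling the nineteen triples apart\<close>

fun signature :: "eperm \<times> eperm \<times> eperm \<Rightarrow> bool list" where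
  "signature (r0, r1, r2) = map (\<lambda>ws. value_of [r0, r1, r2] ws = pone) relators"

text \<open>The sixteen bits of a signature encode the orders of the four
  \<open>words\<close>.\<close>

lemma distinct_signatures: "distinct (map signature reps)"
  by code_simp

lemma set_relators: "ws \<in> set relators \<Longrightarrow> set ws \<subseteq> {..<3}"
  by (auto simp: relators_def words_def)

theorem theorem3p13:
  shows "(\<forall>r0 r1 r2. regular_linear_hypermap (Hypermap A5Z2 r0 r1 r2) \<longrightarrow>
            (\<exists>i\<in>{1..19::nat}. hypermap_iso (Hypermap A5Z2 r0 r1 r2) (MM i))) \<and>
         (\<forall>i\<in>{1..19::nat}. regular_linear_hypermap (MM i)) \<and>
         (\<forall>i\<in>{1..19::nat}. \<forall>j\<in>{1..19::nat}. i \<noteq> j \<longrightarrow> \<not> hypermap_iso (MM i) (MM j))"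
proof (intro conjI allI impI ballI)
  fix r0 r1 r2 assume M: "regular_linear_hypermap (Hypermap A5Z2 r0 r1 r2)"
  define \<psi> where "\<psi> = inv_into (carrier EG) dec"
  have \<psi>: "\<psi> \<in> iso A5Z2 EG"
    unfolding \<psi>_def by (rule group.iso_set_sym[OF group_EG dec_iso])
  have "regular_linear_hypermap (Hypermap EG (\<psi> r0) (\<psi> r1) (\<psi> r2))"
    by (rule regular_linear_hypermap_iso[OF group_A5Z2 group_EG \<psi> M])
  then obtain i \<phi> where i: "i < 19" "reps ! i = (\<phi> (\<psi> r0), \<phi> (\<psi> r1), \<phi> (\<psi> r2))" and \<phi>: "\<phi> \<in> iso EG EG"
    using regular_linear_hypermap_EG_classified by blast
  \<comment> \<open>Through the computable copy and back: this automorphism of \<open>A5Z2\<close>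
    carries the given triple to a listed one.\<close>
  have "dec \<circ> (\<phi> \<circ> \<psi>) \<in> iso A5Z2 A5Z2"
    by (intro iso_set_trans[OF _ dec_iso] iso_set_trans[OF \<psi> \<phi>])
  moreover have "r0 \<in> carrier A5Z2" "r1 \<in> carrier A5Z2" "r2 \<in> carrier A5Z2"
    using M by (auto simp: regular_linear_hypermap_def Let_def involution_def)
  ultimately have "hypermap_iso (Hypermap A5Z2 r0 r1 r2)
      (Hypermap A5Z2 (dec (\<phi> (\<psi> r0))) (dec (\<phi> (\<psi> r1))) (dec (\<phi> (\<psi> r2))))"
    using hypermap_iso_of_iso[of "dec \<circ> (\<phi> \<circ> \<psi>)"] by simp
  \<comment> \<open>\<open>reps\<close> is indexed from 0 and \<open>MM\<close> from 1.\<close>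
  also have "Hypermap A5Z2 (dec (\<phi> (\<psi> r0))) (dec (\<phi> (\<psi> r1))) (dec (\<phi> (\<psi> r2))) = MM (Suc i)"
    using i by (subst MM_eq_reps) auto
  finally show "\<exists>i\<in>{1..19}. hypermap_iso (Hypermap A5Z2 r0 r1 r2) (MM i)"
    using i(1) by (intro bexI[of _ "Suc i"]) auto
next
  fix i :: nat assume i: "i \<in> {1..19}"
  obtain r0 r1 r2 where r: "reps ! (i - 1) = (r0, r1, r2)" by (metis prod_cases3)
  moreover have "reps ! (i - 1) \<in> set reps"
    using i by (intro nth_mem) (auto simp: length_reps)
  ultimately show "regular_linear_hypermap (MM i)"
    using regular_linear_hypermap_iso[OF group_EG group_A5Z2 dec_iso regular_linear_hypermap_reps]
    by (simp add: MM_eq_reps[OF i])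
next
  fix i j :: nat assume i: "i \<in> {1..19}" and j: "j \<in> {1..19}" and ne: "i \<noteq> j"
  show "\<not> hypermap_iso (MM i) (MM j)"
  proof
    assume iso: "hypermap_iso (MM i) (MM j)"
    obtain r0 r1 r2 where r: "reps ! (i - 1) = (r0, r1, r2)" by (metis prod_cases3)
    obtain s0 s1 s2 where s: "reps ! (j - 1) = (s0, s1, s2)" by (metis prod_cases3)
    have lt: "i - 1 < length reps" "j - 1 < length reps"
      using i j by (auto simp: length_reps)
    have rmem: "(r0, r1, r2) \<in> set reps"
      unfolding r[symmetric] by (intro nth_mem lt)
    have smem: "(s0, s1, s2) \<in> set reps"
      unfolding s[symmetric] by (intro nth_mem lt)
    have M: "MM i = Hypermap A5Z2 (dec r0) (dec r1) (dec r2)"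
      and N: "MM j = Hypermap A5Z2 (dec s0) (dec s1) (dec s2)"
      using i j r s by (simp_all add: MM_eq_reps)
    have Mg: "set (gens (MM i)) \<subseteq> carrier (hgroup (MM i))"
      using reps_in_carrier[OF rmem] unfolding M gens_def
      by (simp add: dec_mem_iff del: EG_simps)
    have Ng: "set (gens (MM j)) \<subseteq> carrier (hgroup (MM j))"
      using reps_in_carrier[OF smem] unfolding N gens_def
      by (simp add: dec_mem_iff del: EG_simps)
    \<comment> \<open>An isomorphism preserves which relators hold, and the injective
      \<open>dec\<close> turns this into an equality of computed signatures.\<close>
    have "value_of [r0, r1, r2] ws = pone \<longleftrightarrow> value_of [s0, s1, s2] ws = pone" if "ws \<in> set relators" for ws
      using hypermap_iso_relator[OF iso _ Mg _ Ng set_relators[OF that]] group_A5Z2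
        walk_A5Z2[OF set_relators[OF that]] inj_dec
      by (simp add: M N inj_eq flip: dec_pone)
    hence "map signature reps ! (i - 1) = map signature reps ! (j - 1)"
      using lt r s by simp
    hence "i - 1 = j - 1"
      using lt by (subst (asm) nth_eq_iff_index_eq[OF distinct_signatures]) auto
    thus False using i j ne by auto
  qed
qed

end
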